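(* Let $G=(V,E)$ be an undirected and unweighted graph on $n$ vertices, and let $m=(m_1,m_2,m_3)$ be such that $\mathrm{OPT}_{\mathrm{MC}}\ge\alpha>0$. Then $$\sigma_\infty(G)\ \ge\ m_3+\left\lceil -\frac12+\sqrt{2\lceil\alpha\rceil+\frac14}\,\right\rceil .$$
   Context: Here $m_1,m_2,m_3$ are nonnegative integers with $m_1\ge1$, $m_2\ge1$ and $m_1+m_2+m_3=n=|V|$, and $A=(a_{ij})$ is the adjacency matrix of $G$. The optimal value of the minimum cut problem is $$\mathrm{OPT}_{\mathrm{MC}}:=\min\Big\{\sum_{i\in S_1,\,j\in S_2}a_{ij}\ :\ (S_1,S_2,S_3)\text{ partitions }V,\ |S_i|=m_i,\ i=1,2,3\Big\}.$$ The bandwidth of $G$ is $$\sigma_\infty(G):=\min\Big\{\max_{\{i,j\}\in E}|\phi(i)-\phi(j)|\ :\ \phi:V\to\{1,\dots,n\}\text{ bijective}\Big\}.$$ *)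

theory Defs
  imports Complex_Main "Graph_Theory.Digraph"
begin

text \<open>A finite simple undirected graph is a \<^locale>\<open>graph\<close> in the sense of Graph_Theory: a finite,
  loop-free digraph without parallel arcs whose adjacency relation is symmetric. An undirected
  edge is thus represented by two opposite arcs.\<close>

definition adjacency :: "('a, 'b) pre_digraph \<Rightarrow> 'a \<Rightarrow> 'a \<Rightarrow> nat" where
  "adjacency G i j = (if i \<rightarrow>\<^bsub>G\<^esub> j then 1 else 0)"

text \<open>Parts may be empty (the third part is, when \<open>m\<^sub>3 = 0\<close>), and they are ordered.\<close>

definition tripartition ::
    "'a set \<Rightarrow> nat \<Rightarrow> nat \<Rightarrow> nat \<Rightarrow> 'a set \<Rightarrow> 'a set \<Rightarrow> 'a set \<Rightarrow> bool" where
  "tripartition V m\<^sub>1 m\<^sub>2 m\<^sub>3 S\<^sub>1 S\<^sub>2 S\<^sub>3 \<longleftrightarrow>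
     S\<^sub>1 \<union> S\<^sub>2 \<union> S\<^sub>3 = V \<and>
     S\<^sub>1 \<inter> S\<^sub>2 = {} \<and> S\<^sub>1 \<inter> S\<^sub>3 = {} \<and> S\<^sub>2 \<inter> S\<^sub>3 = {} \<and>
     card S\<^sub>1 = m\<^sub>1 \<and> card S\<^sub>2 = m\<^sub>2 \<and> card S\<^sub>3 = m\<^sub>3"

definition opt_min_cut :: "('a, 'b) pre_digraph \<Rightarrow> nat \<Rightarrow> nat \<Rightarrow> nat \<Rightarrow> nat" where
  "opt_min_cut G m\<^sub>1 m\<^sub>2 m\<^sub>3 =
     Min {\<Sum>i\<in>S\<^sub>1. \<Sum>j\<in>S\<^sub>2. adjacency G i j | S\<^sub>1 S\<^sub>2 S\<^sub>3. tripartition (verts G) m\<^sub>1 m\<^sub>2 m\<^sub>3 S\<^sub>1 S\<^sub>2 S\<^sub>3}"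

text \<open>The element \<open>0\<close> only matters for a graph without edges, whose bandwidth is \<open>0\<close> by
  convention.\<close>

definition labelling_width :: "('a, 'b) pre_digraph \<Rightarrow> ('a \<Rightarrow> nat) \<Rightarrow> int" where
  "labelling_width G \<phi> = Max (insert 0 {\<bar>int (\<phi> i) - int (\<phi> j)\<bar> | i j. i \<rightarrow>\<^bsub>G\<^esub> j})"

definition bandwidth :: "('a, 'b) pre_digraph \<Rightarrow> int" where
  "bandwidth G = Min {labelling_width G \<phi> | \<phi>. bij_betw \<phi> (verts G) {1..card (verts G)}}"

text \<open>Both minima, and the maximum, range over finite nonempty sets, so \<^const>\<open>Min\<close> and
  \<^const>\<open>Max\<close> have their intended meaning.\<close>

lemma finite_cut_values:
  assumes "finite (verts G)"
  shows "finite {\<Sum>i\<in>S\<^sub>1. \<Sum>j\<in>S\<^sub>2. adjacency G i j | S\<^sub>1 S\<^sub>2 S\<^sub>3. tripartition (verts G) m\<^sub>1 m\<^sub>2 m\<^sub>3 S\<^sub>1 S\<^sub>2 S\<^sub>3}"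
proof (rule finite_subset)
  show "{\<Sum>i\<in>S\<^sub>1. \<Sum>j\<in>S\<^sub>2. adjacency G i j | S\<^sub>1 S\<^sub>2 S\<^sub>3. tripartition (verts G) m\<^sub>1 m\<^sub>2 m\<^sub>3 S\<^sub>1 S\<^sub>2 S\<^sub>3}
    \<subseteq> (\<lambda>(S\<^sub>1, S\<^sub>2). \<Sum>i\<in>S\<^sub>1. \<Sum>j\<in>S\<^sub>2. adjacency G i j) ` (Pow (verts G) \<times> Pow (verts G))"
    by (fastforce simp: tripartition_def)
qed (use assms in auto)

lemma cut_values_nonempty:
  assumes "finite (verts G)" "m\<^sub>1 + m\<^sub>2 + m\<^sub>3 = card (verts G)"
  shows "{\<Sum>i\<in>S\<^sub>1. \<Sum>j\<in>S\<^sub>2. adjacency G i j | S\<^sub>1 S\<^sub>2 S\<^sub>3. tripartition (verts G) m\<^sub>1 m\<^sub>2 m\<^sub>3 S\<^sub>1 S\<^sub>2 S\<^sub>3} \<noteq> {}"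
proof -
  obtain S\<^sub>1 where S1: "S\<^sub>1 \<subseteq> verts G" "card S\<^sub>1 = m\<^sub>1" "finite S\<^sub>1"
    using obtain_subset_with_card_n[of m\<^sub>1 "verts G"] assms by auto
  have "card (verts G - S\<^sub>1) = m\<^sub>2 + m\<^sub>3"
    using S1 assms by (simp add: card_Diff_subset)
  then obtain S\<^sub>2 where S2: "S\<^sub>2 \<subseteq> verts G - S\<^sub>1" "card S\<^sub>2 = m\<^sub>2" "finite S\<^sub>2"
    using obtain_subset_with_card_n[of m\<^sub>2 "verts G - S\<^sub>1"] by auto
  have "card (verts G - S\<^sub>1 - S\<^sub>2) = m\<^sub>3"
    using S2 \<open>card (verts G - S\<^sub>1) = m\<^sub>2 + m\<^sub>3\<close> by (simp add: card_Diff_subset)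
  then have "tripartition (verts G) m\<^sub>1 m\<^sub>2 m\<^sub>3 S\<^sub>1 S\<^sub>2 (verts G - S\<^sub>1 - S\<^sub>2)"
    using S1 S2 by (auto simp: tripartition_def)
  then show ?thesis by blast
qed

lemma (in fin_digraph) finite_label_differences:
  "finite {\<bar>int (\<phi> i) - int (\<phi> j)\<bar> | i j. i \<rightarrow>\<^bsub>G\<^esub> j}"
proof -
  have "{\<bar>int (\<phi> i) - int (\<phi> j)\<bar> | i j. i \<rightarrow>\<^bsub>G\<^esub> j}
      = (\<lambda>(i, j). \<bar>int (\<phi> i) - int (\<phi> j)\<bar>) ` arcs_ends G"
    by force
  then show ?thesis by (simp add: arcs_ends_def)
qed

lemma (in fin_digraph) finite_labelling_widths:
  "finite {labelling_width G \<phi> | \<phi>. bij_betw \<phi> (verts G) {1..card (verts G)}}"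
proof (rule finite_subset)
  show "{labelling_width G \<phi> | \<phi>. bij_betw \<phi> (verts G) {1..card (verts G)}}
    \<subseteq> {0..int (card (verts G))}"
  proof clarify
    fix \<phi> assume bij: "bij_betw \<phi> (verts G) {1..card (verts G)}"
    have "\<bar>int (\<phi> i) - int (\<phi> j)\<bar> \<le> int (card (verts G))" if "i \<rightarrow>\<^bsub>G\<^esub> j" for i j
    proof -
      have "i \<in> verts G" "j \<in> verts G"
        using that by (auto simp: arcs_ends_def arc_to_ends_def)
      then have "\<phi> i \<in> {1..card (verts G)}" "\<phi> j \<in> {1..card (verts G)}"
        using bij by (auto simp: bij_betw_def)
      then show ?thesis by auto
    qed
    then show "labelling_width G \<phi> \<in> {0..int (card (verts G))}"
      unfolding labelling_width_def using finite_label_differences[of \<phi>] by auto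
  qed
qed simp

lemma (in fin_digraph) labelling_widths_nonempty:
  "{labelling_width G \<phi> | \<phi>. bij_betw \<phi> (verts G) {1..card (verts G)}} \<noteq> {}"
  using finite_same_card_bij[of "verts G" "{1..card (verts G)}"] by auto

end

theory Submission
  imports Defs
begin

text \<open>Take a labelling \<open>\<phi>\<close> of least width \<open>w\<close> and cut the line at the labels: \<open>S\<^sub>1\<close> gets the \<open>m\<^sub>1\<close>
  smallest labels, \<open>S\<^sub>3\<close> the next \<open>m\<^sub>3\<close> and \<open>S\<^sub>2\<close> the rest. Every edge between \<open>S\<^sub>1\<close> and \<open>S\<^sub>2\<close> has to
  jump over the \<open>m\<^sub>3\<close> labels in the middle, but no edge is longer than \<open>w = m\<^sub>3 + k\<close>. So if its ends
  lie \<open>a\<close> and \<open>b\<close> places away from the two borders of the middle block, then \<open>a + b < k\<close>. There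
  are only \<open>k (k + 1) / 2\<close> such pairs, which bounds the value of this cut (\<open>cut_le_triangle\<close>) and
  hence the minimum cut. As cut values are integers, \<open>\<lceil>\<alpha>\<rceil> \<le> k (k + 1) / 2\<close>, and the claimed
  bound is this inequality solved for \<open>k\<close> (\<open>ceiling_quadratic_root_le\<close>).\<close>

lemma cut_eq_card_crossing:
  assumes "finite S" "finite T"
  shows "(\<Sum>i\<in>S. \<Sum>j\<in>T. adjacency G i j) = card {(i, j) \<in> S \<times> T. i \<rightarrow>\<^bsub>G\<^esub> j}"
proof -
  have "(\<Sum>i\<in>S. \<Sum>j\<in>T. adjacency G i j) = (\<Sum>p\<in>S \<times> T. if fst p \<rightarrow>\<^bsub>G\<^esub> snd p then 1 else 0)"
    by (simp add: sum.cartesian_product adjacency_def case_prod_beta)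
  also have "\<dots> = card {p \<in> S \<times> T. fst p \<rightarrow>\<^bsub>G\<^esub> snd p}"
    using assms by (simp add: sum.If_cases Int_def)
  also have "{p \<in> S \<times> T. fst p \<rightarrow>\<^bsub>G\<^esub> snd p} = {(i, j) \<in> S \<times> T. i \<rightarrow>\<^bsub>G\<^esub> j}"
    by auto
  finally show ?thesis .
qed

lemma card_triangle: "2 * card (SIGMA a:{..<k}. {..<k - a}) = k * (k + 1)" for k :: nat
proof -
  have "card (SIGMA a:{..<k}. {..<k - a}) = (\<Sum>a<k. k - a)"
    by simp
  moreover have "2 * (\<Sum>a<k. k - a) = k * (k + 1)"
  proof (induction k)
    case (Suc k)
    then show ?case by (simp only: sum.lessThan_Suc_shift) simp
  qed simp
  ultimately show ?thesis by simp
qed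

text \<open>Measuring the distance of each label from the nearer border of the block \<open>{p<..q}\<close> maps the
  crossing edges injectively into the triangle \<open>a + b < k\<close>.\<close>

lemma cut_le_triangle:
  fixes \<phi> :: "'a \<Rightarrow> nat"
  assumes "finite S" "finite T" "inj_on \<phi> S" "inj_on \<phi> T" "p \<le> q"
    and S: "\<And>i. i \<in> S \<Longrightarrow> \<phi> i \<le> p"
    and T: "\<And>j. j \<in> T \<Longrightarrow> q < \<phi> j"
    and short: "\<And>i j. i \<in> S \<Longrightarrow> j \<in> T \<Longrightarrow> i \<rightarrow>\<^bsub>G\<^esub> j \<Longrightarrow> \<phi> j - \<phi> i \<le> (q - p) + k"
  shows "2 * (\<Sum>i\<in>S. \<Sum>j\<in>T. adjacency G i j) \<le> k * (k + 1)"
proof -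
  let ?C = "{(i, j) \<in> S \<times> T. i \<rightarrow>\<^bsub>G\<^esub> j}"
  let ?f = "\<lambda>(i, j). (p - \<phi> i, \<phi> j - Suc q)"
  have "inj_on ?f ?C"
  proof (rule inj_onI, clarify)
    fix i j i' j'
    assume mem: "i \<in> S" "j \<in> T" "i' \<in> S" "j' \<in> T"
      and "p - \<phi> i = p - \<phi> i'" "\<phi> j - Suc q = \<phi> j' - Suc q"
    then have "\<phi> i = \<phi> i'" "\<phi> j = \<phi> j'"
      using S[of i] S[of i'] T[of j] T[of j'] by auto
    then show "i = i' \<and> j = j'"
      using mem assms(3,4) by (auto dest: inj_onD)
  qed
  moreover have "?f ` ?C \<subseteq> (SIGMA a:{..<k}. {..<k - a})"
  proof clarsimp
    fix i j assume "i \<in> S" "j \<in> T" "i \<rightarrow>\<^bsub>G\<^esub> j"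
    then show "p - \<phi> i < k \<and> \<phi> j - Suc q < k - (p - \<phi> i)"
      using S[of i] T[of j] short[of i j] \<open>p \<le> q\<close> by linarith
  qed
  ultimately have "card ?C \<le> card (SIGMA a:{..<k}. {..<k - a})"
    by (intro card_inj_on_le[of ?f]) auto
  then show ?thesis
    using card_triangle[of k] cut_eq_card_crossing[OF assms(1,2), of G] by linarith
qed

lemma tripartition_of_labelling:
  assumes bij: "bij_betw \<phi> V {1..card V}" and size: "m\<^sub>1 + m\<^sub>2 + m\<^sub>3 = card V"
  shows "tripartition V m\<^sub>1 m\<^sub>2 m\<^sub>3 {v \<in> V. \<phi> v \<le> m\<^sub>1} {v \<in> V. m\<^sub>1 + m\<^sub>3 < \<phi> v}
    {v \<in> V. m\<^sub>1 < \<phi> v \<and> \<phi> v \<le> m\<^sub>1 + m\<^sub>3}"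
proof -
  have preimage: "card {v \<in> V. P (\<phi> v)} = card {l \<in> {1..card V}. P l}" for P
  proof (rule bij_betw_same_card[of \<phi>])
    have img: "\<phi> ` V = {1..card V}" and inj: "inj_on \<phi> V"
      using bij by (auto simp: bij_betw_def)
    have "\<phi> ` {v \<in> V. P (\<phi> v)} = {l \<in> {1..card V}. P l}"
      unfolding img[symmetric] by auto
    then show "bij_betw \<phi> {v \<in> V. P (\<phi> v)} {l \<in> {1..card V}. P l}"
      using inj by (auto simp: bij_betw_def intro: inj_on_subset)
  qed
  have "{l \<in> {1..card V}. l \<le> m\<^sub>1} = {1..m\<^sub>1}"
    "{l \<in> {1..card V}. m\<^sub>1 + m\<^sub>3 < l} = {m\<^sub>1 + m\<^sub>3<..card V}"
    "{l \<in> {1..card V}. m\<^sub>1 < l \<and> l \<le> m\<^sub>1 + m\<^sub>3} = {m\<^sub>1<..m\<^sub>1 + m\<^sub>3}"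
    using size by auto
  then have "card {v \<in> V. \<phi> v \<le> m\<^sub>1} = m\<^sub>1" "card {v \<in> V. m\<^sub>1 + m\<^sub>3 < \<phi> v} = m\<^sub>2"
    "card {v \<in> V. m\<^sub>1 < \<phi> v \<and> \<phi> v \<le> m\<^sub>1 + m\<^sub>3} = m\<^sub>3"
    using preimage[of "\<lambda>l. l \<le> m\<^sub>1"] preimage[of "\<lambda>l. m\<^sub>1 + m\<^sub>3 < l"]
      preimage[of "\<lambda>l. m\<^sub>1 < l \<and> l \<le> m\<^sub>1 + m\<^sub>3"] size by auto
  then show ?thesis
    unfolding tripartition_def by auto
qed

lemma opt_min_cut_le:
  assumes "finite (verts G)" "tripartition (verts G) m\<^sub>1 m\<^sub>2 m\<^sub>3 S\<^sub>1 S\<^sub>2 S\<^sub>3"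
  shows "opt_min_cut G m\<^sub>1 m\<^sub>2 m\<^sub>3 \<le> (\<Sum>i\<in>S\<^sub>1. \<Sum>j\<in>S\<^sub>2. adjacency G i j)"
  unfolding opt_min_cut_def using assms by (intro Min_le finite_cut_values) auto

lemma (in fin_digraph) arc_le_labelling_width:
  assumes "i \<rightarrow>\<^bsub>G\<^esub> j"
  shows "\<bar>int (\<phi> i) - int (\<phi> j)\<bar> \<le> labelling_width G \<phi>"
  unfolding labelling_width_def using assms finite_label_differences[of \<phi>]
  by (intro Max_ge) auto

lemma (in fin_digraph) bandwidth_attained:
  obtains \<phi> where "bij_betw \<phi> (verts G) {1..card (verts G)}" "bandwidth G = labelling_width G \<phi>"
  using Min_in[OF finite_labelling_widths labelling_widths_nonempty]
  unfolding bandwidth_def by blast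

text \<open>For \<open>c \<ge> 0\<close> the number under the ceiling is the larger root \<open>x\<close> of \<open>x (x + 1) = 2 c\<close>.\<close>

lemma ceiling_quadratic_root_le:
  fixes c :: int and k :: nat
  assumes "2 * c \<le> int (k * (k + 1))"
  shows "\<lceil>- (1 / 2) + sqrt (2 * of_int c + 1 / 4)\<rceil> \<le> int k"
proof -
  have "real_of_int (2 * c) \<le> real_of_int (int (k * (k + 1)))"
    using assms by (simp only: of_int_le_iff)
  then have "2 * real_of_int c + 1 / 4 \<le> (real k + 1 / 2)\<^sup>2"
    by (simp add: power2_eq_square algebra_simps)
  then have "sqrt (2 * real_of_int c + 1 / 4) \<le> real k + 1 / 2"
    by (intro real_le_lsqrt) auto
  then show ?thesis
    by (simp add: ceiling_le_iff)
qed

theorem proposition4: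
  fixes G :: "('a, 'b) pre_digraph"
    and m\<^sub>1 m\<^sub>2 m\<^sub>3 :: nat
    and \<alpha> :: real
  assumes "graph G"
    and "m\<^sub>1 \<ge> 1"
    and "m\<^sub>2 \<ge> 1"
    and "m\<^sub>1 + m\<^sub>2 + m\<^sub>3 = card (verts G)"
    and "real (opt_min_cut G m\<^sub>1 m\<^sub>2 m\<^sub>3) \<ge> \<alpha>"
    and "\<alpha> > 0"
  shows "bandwidth G \<ge> int m\<^sub>3 + \<lceil>- (1 / 2) + sqrt (2 * of_int \<lceil>\<alpha>\<rceil> + 1 / 4)\<rceil>"
proof -
  interpret graph G by fact
  obtain \<phi> where bij: "bij_betw \<phi> (verts G) {1..card (verts G)}"
    and width: "bandwidth G = labelling_width G \<phi>"
    by (rule bandwidth_attained)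
  \<comment> \<open>Truncating at \<open>0\<close> is harmless: \<open>k = 0\<close> would make the cut empty, against \<open>\<alpha> > 0\<close>.\<close>
  define k where "k = nat (bandwidth G - int m\<^sub>3)"
  let ?S = "{v \<in> verts G. \<phi> v \<le> m\<^sub>1}" and ?T = "{v \<in> verts G. m\<^sub>1 + m\<^sub>3 < \<phi> v}"
  have inj: "inj_on \<phi> A" if "A \<subseteq> verts G" for A
    using bij that by (auto simp: bij_betw_def intro: inj_on_subset)
  have "\<phi> j - \<phi> i \<le> (m\<^sub>1 + m\<^sub>3 - m\<^sub>1) + k" if "i \<rightarrow>\<^bsub>G\<^esub> j" for i j
    using arc_le_labelling_width[OF that, of \<phi>] width unfolding k_def by linarith
  then have "2 * (\<Sum>i\<in>?S. \<Sum>j\<in>?T. adjacency G i j) \<le> k * (k + 1)"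
    by (intro cut_le_triangle[where \<phi> = \<phi> and p = "m\<^sub>1" and q = "m\<^sub>1 + m\<^sub>3"] inj) auto
  moreover have "opt_min_cut G m\<^sub>1 m\<^sub>2 m\<^sub>3 \<le> (\<Sum>i\<in>?S. \<Sum>j\<in>?T. adjacency G i j)"
    using tripartition_of_labelling[OF bij assms(4)] by (intro opt_min_cut_le) auto
  moreover have "\<lceil>\<alpha>\<rceil> \<le> int (opt_min_cut G m\<^sub>1 m\<^sub>2 m\<^sub>3)"
    using assms(5) by (simp add: ceiling_le_iff)
  ultimately have bound: "2 * \<lceil>\<alpha>\<rceil> \<le> int (k * (k + 1))"
    by linarith
  have "0 < \<lceil>\<alpha>\<rceil>"
    using assms(6) by simp
  then have "k \<noteq> 0"
    using bound by (cases "k = 0") auto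
  then have "bandwidth G = int m\<^sub>3 + int k"
    unfolding k_def by linarith
  then show ?thesis
    using ceiling_quadratic_root_le[OF bound] by linarith
qed

end
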